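(* The ideal $J(2,P)\subseteq B(2,P)$ is homogeneous for the $\mathbb Z([2]\times P)$-grading on $B(2,P)$. Moreover: (1) $T(p)$ is homogeneous of degree $p_1+\hat p$. (2) If $p\le q$ then $S_p(q)$ is homogeneous of degree $q_2-\hat p$. (3) When $p$ and $q$ are siblings, $S_qT_q(p)$ is homogeneous of degree $p_1+\hat p-\hat q$. (4) If $q$ is a child of $p$, the determinant $D(p)^q$ is homogeneous of degree $\hat q-\hat p$. The determinant $D(p)^p$ is homogeneous of degree $p_2-\hat p$.
   Context: Let $\Bbbk$ be a field and let $P$ be a finite poset whose Hasse diagram is a rooted tree with the root at the bottom: $P$ has a unique minimal element $\rho$ (the root), and every $p\neq\rho$ covers exactly one element, its parent. Write $a\prec b$ if $b$ covers $a$ ($a$ is the parent of $b$, $b$ is a child of $a$). Two elements are siblings if they have the same parent. For $p\in P$ and $i\in\{1,2\}$ there is a variable $x_{i,p}$, written $p_i$; $\Bbbk[x_{[2]\times P}]$ is the polynomial ring in these variables. Let $B=\Bbbk[u_{\emptyset,\rho},u_{q,p}]$ be the polynomial ring in a variable $u_{\emptyset,\rho}$ and variables $u_{q,p}$, one for each pair $(q,p)$ in $P$ with $p\ne\rho$ such that the meet of $q$ and $p$ is the parent of $p$ (i.e. $q$ is the parent of $p$ or $q\ge c$ for a sibling $c\neq p$ of $p$). Let $B(2,P)=B\otimes_\Bbbk\Bbbk[x_{[2]\times P}]$. Polynomials $T$: for distinct siblings $b,c$ let $T_c(b)=-\sum_{q\ge c}q_2u_{q,b}$; if $a$ is the parent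 of $b$ let $T_a(b)=-a_2u_{a,b}$; let $T(b)=T_b(b)=-T_a(b)-\sum_cT_c(b)$, summing over siblings $c\ne b$ of $b$; and $T(\rho)=u_{\emptyset,\rho}$. Polynomials $D$ and $S$ in $B(2,P)$ are defined by induction on $\mathrm{depth}(a)$, the length of the longest chain upwards starting from $a$. Each $S_a$ is defined on the variables $b_2$ with $b\ge a$ and extended $B$-linearly to $B$-linear combinations of them; one writes $S_a(b)$ for $S_a(b_2)$. The following expressions are used: $S_bT_b(b):=b_1$; $S_aT_a(b):=-u_{a,b}$ if $a$ is the parent of $b$; $S_cT_c(b):=S_c(T_c(b))=-\sum_{q\ge c}u_{q,b}S_c(q)$ for distinct siblings $b,c$. If $a$ is maximal, $D(a)^a=1$ and $S_a(a)=1$. Otherwise let $b^1,\dots,b^m$ be the children of $a$, put $b^0=a$, and let $M(a)=[S_{b^i}T_{b^i}(b^j)]$ be the $m\times(m+1)$ matrix with column index $i=0,\dots,m$ and row index $j=1,\dots,m$; put $D(a)^{b^i}=(-1)^i|M(a)^{b^i}|$, where $M(a)^{b^i}$ is $M(a)$ with column $i$ deleted. For $a\le b$ let $R(a,b)=\prod_{a\le p\prec q\le b}D(p)^q$ (product over the covering relations between $a$ and $b$; $R(a,a)=1$), and $S_a(b_2)=R(a,b)\,D(b)^b$. $J(2,P)\subseteq B(2,P)$ is the ideal generated by $p_1q_2-T(p)S_p(q)$ for all $p\le q$ in $P$. Grading: $\mathbb Z([2]\times P)$ is the free abelian group of rank $2|P|$ on symbols $p_1,p_2$ ($p\in P$).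 For $p\in P$ with children $b^1,\dots,b^m$ put $\hat p=p_2-b^1_1-\cdots-b^m_1$. Grade $B(2,P)$ by giving the variable $p_i$ degree $p_i$, the variable $u_{q,p}$ degree $p_1-q_2+\hat p$, and $u_{\emptyset,\rho}$ degree $\rho_1+\hat\rho$. *)

theory Defs
  imports
    "HOL-Library.Poly_Mapping"
    "HOL-Algebra.Ideal"
    "Jordan_Normal_Form.Determinant"
    "Jordan_Normal_Form.DL_Submatrix"
begin

section \<open>Rooted tree posets\<close>

text \<open>The finite poset \<open>P\<close> is a type of class \<open>finite\<close> and \<open>order\<close>.
  \<open>a \<prec> b\<close> means that \<open>b\<close> covers \<open>a\<close>.\<close>

definition covered_by :: "'p::order \<Rightarrow> 'p \<Rightarrow> bool"  (infix "\<prec>" 50)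
  where "a \<prec> b \<longleftrightarrow> a < b \<and> \<not> (\<exists>c. a < c \<and> c < b)"

definition is_root :: "'p::order \<Rightarrow> bool"
  where "is_root r \<longleftrightarrow> \<not> (\<exists>p. p < r)"

definition rooted_tree :: "'p::order itself \<Rightarrow> bool"
  where "rooted_tree _ \<longleftrightarrow>
    (\<exists>!r::'p. is_root r) \<and> (\<forall>p::'p. \<not> is_root p \<longrightarrow> (\<exists>!a. a \<prec> p))"

definition root :: "'p::order"
  where "root = (THE r. is_root r)"

definition parent :: "'p::order \<Rightarrow> 'p"
  where "parent b = (THE a. a \<prec> b)"

definition siblings :: "'p::order \<Rightarrow> 'p \<Rightarrow> bool"
  where "siblings b c \<longleftrightarrow> (\<exists>a. a \<prec> b \<and> a \<prec> c)"

definition is_meet :: "'p::order \<Rightarrow> 'p \<Rightarrow> 'p \<Rightarrow> bool"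
  where "is_meet m q p \<longleftrightarrow> m \<le> q \<and> m \<le> p \<and> (\<forall>z. z \<le> q \<and> z \<le> p \<longrightarrow> z \<le> m)"

text \<open>\<open>kids a\<close> is an enumeration \<open>b\<^sup>1, \<dots>, b\<^sup>m\<close> of the children of \<open>a\<close>; the order in which
  the children are listed is arbitrary.\<close>

definition enumerates_children :: "('p::order \<Rightarrow> 'p list) \<Rightarrow> bool"
  where "enumerates_children kids \<longleftrightarrow> (\<forall>a. distinct (kids a) \<and> set (kids a) = {b. a \<prec> b})"


section \<open>The polynomial ring \<open>B(2,P)\<close>\<close>

datatype two = One | Two

text \<open>\<open>X (i, p)\<close> is the variable \<open>p\<^sub>i\<close>, \<open>U0\<close> is \<open>u\<close> indexed by the empty set and the root,
  and \<open>U q p\<close> is \<open>u\<close> indexed by \<open>q, p\<close>. The type has a \<open>U q p\<close> for every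
  pair; those that exist in \<open>B(2,P)\<close> are singled out by \<open>is_var\<close>.\<close>

datatype 'p var = X "two \<times> 'p" | U0 | U 'p 'p

fun is_var :: "'p::order var \<Rightarrow> bool" where
  "is_var (X ip) = True"
| "is_var U0 = True"
| "is_var (U q p) = (p \<noteq> root \<and> is_meet (parent p) q p)"

type_synonym ('p, 'k) poly2 = "('p var \<Rightarrow>\<^sub>0 nat) \<Rightarrow>\<^sub>0 'k"

abbreviation mpvar :: "'p var \<Rightarrow> ('p, 'k::field) poly2"
  where "mpvar v \<equiv> Poly_Mapping.single (Poly_Mapping.single v 1) 1"

abbreviation x1 :: "'p \<Rightarrow> ('p, 'k::field) poly2" where "x1 p \<equiv> mpvar (X (One, p))"
abbreviation x2 :: "'p \<Rightarrow> ('p, 'k::field) poly2" where "x2 p \<equiv> mpvar (X (Two, p))"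
abbreviation u0 :: "('p, 'k::field) poly2" where "u0 \<equiv> mpvar U0"
abbreviation u :: "'p \<Rightarrow> 'p \<Rightarrow> ('p, 'k::field) poly2" where "u q p \<equiv> mpvar (U q p)"

text \<open>\<open>B(2,P)\<close>, being the tensor product of two polynomial rings over the field, is the polynomial
  ring in all of their variables.\<close>

definition B2 :: "('p::order, 'k::field) poly2 set"
  where "B2 = {f. \<forall>m \<in> Poly_Mapping.keys f. \<forall>v \<in> Poly_Mapping.keys m. is_var v}"

definition B2_ring :: "('p::order, 'k::field) poly2 ring"
  where "B2_ring = \<lparr>carrier = B2, monoid.mult = (*), one = 1, zero = 0, add = (+)\<rparr>"


section \<open>The polynomials \<open>T\<close>, \<open>D\<close> and \<open>S\<close>\<close>

text \<open>\<open>T_part c b\<close> is \<open>T\<^sub>c(b)\<close> for \<open>c\<close> the parent or a sibling (other than \<open>b\<close>) of \<open>b\<close>;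
  \<open>T\<^sub>b(b)\<close> is \<open>polyT b\<close>.\<close>

definition T_part :: "'p::{finite,order} \<Rightarrow> 'p \<Rightarrow> ('p, 'k::field) poly2"
  where "T_part c b =
    (if c \<prec> b then - (x2 c * u c b) else - (\<Sum>q | c \<le> q. x2 q * u q b))"

definition polyT :: "'p::{finite,order} \<Rightarrow> ('p, 'k::field) poly2"
  where "polyT b =
    (if b = root then u0
     else - T_part (parent b) b - (\<Sum>c | siblings c b \<and> c \<noteq> b. T_part c b))"

text \<open>The recursion for \<open>D\<close> goes through \<open>R\<close>, \<open>S\<close> and the matrix \<open>M\<close>, so these are first given
  relative to an arbitrary \<open>D\<close>; \<open>D p q\<close> stands for \<open>D(p)\<close> with superscript \<open>q\<close>.\<close>

definition R_of :: "('p::{finite,order} \<Rightarrow> 'p \<Rightarrow> ('p, 'k::field) poly2) \<Rightarrow> 'p \<Rightarrow> 'p \<Rightarrow> ('p, 'k) poly2"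
  where "R_of D a b = (\<Prod>(p, q) \<in> {(p, q). a \<le> p \<and> p \<prec> q \<and> q \<le> b}. D p q)"

definition S_of :: "('p::{finite,order} \<Rightarrow> 'p \<Rightarrow> ('p, 'k::field) poly2) \<Rightarrow> 'p \<Rightarrow> 'p \<Rightarrow> ('p, 'k) poly2"
  where "S_of D a b = R_of D a b * D b b"

text \<open>\<open>ST_of D c b\<close> is \<open>S\<^sub>cT\<^sub>c(b)\<close> for \<open>c\<close> equal to \<open>b\<close>, the parent of \<open>b\<close>, or another sibling of
  \<open>b\<close>. The last case is the \<open>B\<close>-linear extension of \<open>S\<^sub>c\<close> evaluated at \<open>T_part c b\<close>.\<close>

definition ST_of :: "('p::{finite,order} \<Rightarrow> 'p \<Rightarrow> ('p, 'k::field) poly2) \<Rightarrow> 'p \<Rightarrow> 'p \<Rightarrow> ('p, 'k) poly2"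
  where "ST_of D c b =
    (if c = b then x1 b
     else if c \<prec> b then - u c b
     else - (\<Sum>q | c \<le> q. u q b * S_of D c q))"

text \<open>Rows of the library's matrices are numbered from \<open>0\<close>, so row \<open>j\<close> belongs to
  \<open>b\<^sup>j\<^sup>+\<^sup>1 = kids a ! j\<close>, whereas column \<open>i\<close> belongs to \<open>b\<^sup>i = (a # kids a) ! i\<close>, with
  \<open>b\<^sup>0 = a\<close>.\<close>

definition M_of :: "('p::{finite,order} \<Rightarrow> 'p list) \<Rightarrow> ('p \<Rightarrow> 'p \<Rightarrow> ('p, 'k::field) poly2) \<Rightarrow> 'p
    \<Rightarrow> ('p, 'k) poly2 mat"
  where "M_of kids D a =
    mat (length (kids a)) (Suc (length (kids a))) (\<lambda>(j, i). ST_of D ((a # kids a) ! i) (kids a ! j))"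

definition D_step :: "('p::{finite,order} \<Rightarrow> 'p list) \<Rightarrow> ('p \<Rightarrow> 'p \<Rightarrow> ('p, 'k::field) poly2) \<Rightarrow> 'p
    \<Rightarrow> 'p \<Rightarrow> ('p, 'k) poly2"
  where "D_step kids D a b =
    (if kids a = [] then 1
     else let i = (THE i. i \<le> length (kids a) \<and> (a # kids a) ! i = b)
          in (-1) ^ i * det (submatrix (M_of kids D a) UNIV (- {i})))"

text \<open>\<open>polyD kids a b\<close>, meaningful for \<open>b = a\<close> and for \<open>b\<close> a child of \<open>a\<close>, is defined by
  recursion from the maximal elements down to the root; the recursion equation
  is \<open>polyD_rec\<close> below.\<close>

definition polyD :: "('p::{finite,order} \<Rightarrow> 'p list) \<Rightarrow> 'p \<Rightarrow> 'p \<Rightarrow> ('p, 'k::field) poly2"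
  where "polyD kids = wfrec {(p, a). a < p} (D_step kids)"

definition polyS :: "('p::{finite,order} \<Rightarrow> 'p list) \<Rightarrow> 'p \<Rightarrow> 'p \<Rightarrow> ('p, 'k::field) poly2"
  where "polyS kids = S_of (polyD kids)"

definition polyST :: "('p::{finite,order} \<Rightarrow> 'p list) \<Rightarrow> 'p \<Rightarrow> 'p \<Rightarrow> ('p, 'k::field) poly2"
  where "polyST kids = ST_of (polyD kids)"

lemma S_of_cong:
  assumes "\<And>p q. c \<le> p \<Longrightarrow> D p q = D' p q" and "c \<le> b"
  shows "S_of D c b = S_of D' c b"
  unfolding S_of_def R_of_def using assms by (auto intro!: arg_cong2[where f = "(*)"] prod.cong)

lemma D_step_cong:
  assumes "enumerates_children kids" and "\<And>p q. a < p \<Longrightarrow> D p q = D' p q"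
  shows "D_step kids D a = D_step kids D' a"
proof -
  have ST: "ST_of D c b = ST_of D' c b" if "c = a \<or> a \<prec> c" "a \<prec> b" for b c
  proof (cases "a \<prec> c")
    case True
    then have "D p q = D' p q" if "c \<le> p" for p q
      using assms(2) that by (auto simp: covered_by_def)
    then have "S_of D c q = S_of D' c q" if "c \<le> q" for q
      using that by (intro S_of_cong)
    then show ?thesis
      by (auto simp: ST_of_def intro!: sum.cong)
  next
    case False
    with that show ?thesis by (auto simp: ST_of_def)
  qed
  have "M_of kids D a = M_of kids D' a"
  proof -
    have kid: "a \<prec> kids a ! j" if "j < length (kids a)" for j
      using assms(1) that nth_mem[OF that] by (auto simp: enumerates_children_def)
    have "ST_of D ((a # kids a) ! i) (kids a ! j) = ST_of D' ((a # kids a) ! i) (kids a ! j)"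
      if "j < length (kids a)" "i < Suc (length (kids a))" for i j
      using that kid by (intro ST) (auto simp: nth_Cons split: nat.split)
    then show ?thesis
      unfolding M_of_def by (intro cong_mat) auto
  qed
  then show ?thesis
    by (auto simp: D_step_def)
qed

lemma polyD_rec:
  fixes kids :: "'p::{finite,order} \<Rightarrow> 'p list"
  assumes "enumerates_children kids"
  shows "polyD kids a = D_step kids (polyD kids) a"
proof -
  have "wf {(p, a::'p). a < p}"
    by (rule finite_acyclic_wf) (auto intro!: acyclicI_order[where f = id])
  then have "polyD kids a = D_step kids (cut (polyD kids) {(p, a). a < p} a) a"
    unfolding polyD_def by (rule wfrec)
  also have "\<dots> = D_step kids (polyD kids) a"
    using assms by (rule D_step_cong) (simp add: cut_apply)
  finally show ?thesis .
qed


section \<open>The ideal \<open>J(2,P)\<close>\<close>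

definition idealJ :: "('p::{finite,order} \<Rightarrow> 'p list) \<Rightarrow> ('p, 'k::field) poly2 set"
  where "idealJ kids = Idl\<^bsub>B2_ring\<^esub> {x1 p * x2 q - polyT p * polyS kids p q | p q. p \<le> q}"


section \<open>The grading\<close>

text \<open>The degree group is the free abelian group on the pairs \<open>(i, p)\<close>, whose basis elements are
  \<open>frag_of (i, p)\<close>.\<close>

type_synonym 'p deg = "(two \<times> 'p) \<Rightarrow>\<^sub>0 int"

abbreviation e1 :: "'p \<Rightarrow> 'p deg" where "e1 p \<equiv> frag_of (One, p)"
abbreviation e2 :: "'p \<Rightarrow> 'p deg" where "e2 p \<equiv> frag_of (Two, p)"

definition hat :: "'p::{finite,order} \<Rightarrow> 'p deg"
  where "hat p = e2 p - (\<Sum>b | p \<prec> b. e1 b)"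

fun var_deg :: "'p::{finite,order} var \<Rightarrow> 'p deg" where
  "var_deg (X ip) = frag_of ip"
| "var_deg U0 = e1 root + hat root"
| "var_deg (U q p) = e1 p - e2 q + hat p"

definition mon_deg :: "('p::{finite,order} var \<Rightarrow>\<^sub>0 nat) \<Rightarrow> 'p deg"
  where "mon_deg m =
    (\<Sum>v \<in> Poly_Mapping.keys m. frag_cmul (int (Poly_Mapping.lookup m v)) (var_deg v))"

text \<open>As usual, \<open>0\<close> is homogeneous of every degree.\<close>

definition homogeneous :: "'p deg \<Rightarrow> ('p::{finite,order}, 'k::field) poly2 \<Rightarrow> bool"
  where "homogeneous d f \<longleftrightarrow> f \<in> B2 \<and> (\<forall>m \<in> Poly_Mapping.keys f. mon_deg m = d)"

definition hom_component :: "'p deg \<Rightarrow> ('p::{finite,order}, 'k::field) poly2 \<Rightarrow> ('p, 'k) poly2"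
  where "hom_component d f =
    (\<Sum>m | m \<in> Poly_Mapping.keys f \<and> mon_deg m = d. Poly_Mapping.single m (Poly_Mapping.lookup f m))"

definition homogeneous_ideal :: "('p::{finite,order}, 'k::field) poly2 set \<Rightarrow> bool"
  where "homogeneous_ideal I \<longleftrightarrow> ideal I B2_ring \<and> (\<forall>f \<in> I. \<forall>d. hom_component d f \<in> I)"

end

theory Submission
  imports Defs
begin

text \<open>Every polynomial of the construction is assembled from variables by sums of terms of equal
  degree, products and determinants, and the degree of \<open>u\<^bsub>q,p\<^esub>\<close> is chosen so that all degrees
  balance. For \<open>p\<close> other than the root, the summands of \<open>T(p)\<close> have the form \<open>q\<^sub>2 u\<^bsub>q,p\<^esub>\<close>
  up to sign, and all have the degree \<open>p\<^sub>1 + hat p\<close>, as \<open>q\<^sub>2\<close> cancels. The order of \<open>P\<close> enters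
  through the need to know that the variables \<open>u\<^bsub>q,p\<^esub>\<close> that occur belong to
  \<open>B(2,P)\<close>; this is a fact about meets in a tree (\<open>is_var_U_parent\<close>, \<open>is_var_U_sibling\<close>).

  The degrees of \<open>D(a)\<close> are found by induction from the maximal elements down to the root.
  Suppose that they are as claimed above \<open>a\<close>. Along a chain from \<open>c > a\<close> to \<open>q\<close> the differences
  \<open>hat q' - hat p'\<close> contributed by \<open>D(p')\<^bsup>q'\<^esup>\<close> telescope, so \<open>R(c,q)\<close> has degree \<open>hat q - hat c\<close> and
  \<open>S\<^sub>c(q)\<close> has degree \<open>q\<^sub>2 - hat c\<close> (\<open>homogeneous_R_of\<close>, \<open>homogeneous_S_of\<close>). Hence the entry of
  \<open>M(a)\<close> in the row of a child \<open>b\<close> has degree \<open>b\<^sub>1 + hat b - hat c\<close> in the column of a child \<open>c\<close>,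
  and \<open>b\<^sub>1 + hat b - a\<^sub>2\<close> in the column of \<open>a\<close>. These are differences of a row weight and a column
  weight, so every term of the Leibniz expansion of a maximal minor has the same degree, namely
  the sum of all row weights minus the sum of the remaining column weights
  (\<open>homogeneous_maximal_minor\<close>). As \<open>hat a = a\<^sub>2 - \<Sum>b\<^sub>1\<close>, summed over the children \<open>b\<close> of \<open>a\<close>, this
  equals the weight of the deleted column minus \<open>hat a\<close>, which is the claim for \<open>D(a)\<close>.

  Finally, both terms of a generator \<open>p\<^sub>1 q\<^sub>2 - T(p) S\<^sub>p(q)\<close> of \<open>J(2,P)\<close> have degree \<open>p\<^sub>1 + q\<^sub>2\<close>, and an
  ideal generated by homogeneous elements is homogeneous (\<open>homogeneous_ideal_genideal\<close>).\<close>

section \<open>Homogeneous polynomials\<close>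

lemma B2_add: "f \<in> B2 \<Longrightarrow> g \<in> B2 \<Longrightarrow> f + g \<in> B2"
  using keys_add[of f g] by (auto simp: B2_def)

lemma B2_mult: "f * g \<in> B2" if "f \<in> B2" "g \<in> B2"
proof -
  have "is_var v" if m: "m \<in> Poly_Mapping.keys (f * g)" and v: "v \<in> Poly_Mapping.keys m" for m v
  proof -
    obtain a b where ab: "m = a + b" "a \<in> Poly_Mapping.keys f" "b \<in> Poly_Mapping.keys g"
      using m keys_mult[of f g] by blast
    then have "v \<in> Poly_Mapping.keys a \<union> Poly_Mapping.keys b"
      using v keys_add[of a b] by blast
    then show ?thesis
      using ab \<open>f \<in> B2\<close> \<open>g \<in> B2\<close> by (auto simp: B2_def)
  qed
  then show ?thesis by (auto simp: B2_def)
qed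

lemma B2_uminus: "f \<in> B2 \<Longrightarrow> - f \<in> B2"
  by (simp add: B2_def)

lemma B2_0: "0 \<in> B2" and B2_1: "1 \<in> B2"
  by (auto simp: B2_def)

lemma mon_deg_add: "mon_deg (m + n) = mon_deg m + mon_deg n"
proof -
  let ?K = "Poly_Mapping.keys m \<union> Poly_Mapping.keys n"
  have *: "mon_deg k = (\<Sum>v\<in>?K. frag_cmul (int (Poly_Mapping.lookup k v)) (var_deg v))"
    if "Poly_Mapping.keys k \<subseteq> ?K" for k
    unfolding mon_deg_def using that
    by (intro sum.mono_neutral_left) (auto simp: in_keys_iff)
  show ?thesis
    by (simp add: * keys_add lookup_add frag_cmul_distrib sum.distrib)
qed

lemma mon_deg_0 [simp]: "mon_deg 0 = 0"
  by (simp add: mon_deg_def)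

lemma homogeneous_in_B2: "homogeneous d f \<Longrightarrow> f \<in> B2"
  by (simp add: homogeneous_def)

lemma homogeneous_0: "homogeneous d 0"
  by (simp add: homogeneous_def B2_0)

lemma homogeneous_1: "homogeneous 0 1"
  by (simp add: homogeneous_def B2_1)

lemma homogeneous_var: "is_var v \<Longrightarrow> homogeneous (var_deg v) (mpvar v)"
  by (simp add: homogeneous_def B2_def mon_deg_def)

lemma homogeneous_x1: "homogeneous (e1 p) (x1 p :: ('p::{finite,order}, 'k::field) poly2)"
  using homogeneous_var[of "X (One, p)"] by simp

lemma homogeneous_x2: "homogeneous (e2 p) (x2 p :: ('p::{finite,order}, 'k::field) poly2)"
  using homogeneous_var[of "X (Two, p)"] by simp

lemma homogeneous_u:
  "is_var (U q b) \<Longrightarrow> homogeneous (e1 b - e2 q + hat b) (u q b :: ('p::{finite,order}, 'k::field) poly2)"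
  using homogeneous_var[of "U q b"] by simp

lemma homogeneous_add: "homogeneous d f \<Longrightarrow> homogeneous d g \<Longrightarrow> homogeneous d (f + g)"
  using keys_add[of f g] by (auto simp: homogeneous_def B2_add)

lemma homogeneous_uminus: "homogeneous d f \<Longrightarrow> homogeneous d (- f)"
  by (simp add: homogeneous_def B2_uminus)

lemma homogeneous_diff: "homogeneous d f \<Longrightarrow> homogeneous d g \<Longrightarrow> homogeneous d (f - g)"
  using homogeneous_add[of d f "- g"] by (simp add: homogeneous_uminus)

lemma homogeneous_mult: "homogeneous d f \<Longrightarrow> homogeneous e g \<Longrightarrow> homogeneous (d + e) (f * g)"
  using keys_mult[of f g] by (fastforce simp: homogeneous_def B2_mult mon_deg_add)

lemma homogeneous_sum: "(\<And>i. i \<in> I \<Longrightarrow> homogeneous d (f i)) \<Longrightarrow> homogeneous d (sum f I)"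
  by (induction I rule: infinite_finite_induct) (auto simp: homogeneous_0 homogeneous_add)

lemma homogeneous_prod:
  "(\<And>i. i \<in> I \<Longrightarrow> homogeneous (d i) (f i)) \<Longrightarrow> homogeneous (sum d I) (prod f I)"
  by (induction I rule: infinite_finite_induct) (auto simp: homogeneous_1 homogeneous_mult)

lemma homogeneous_minus_one_power: "homogeneous 0 ((- 1) ^ n)"
  using homogeneous_prod[of "{..<n}" "\<lambda>_. 0" "\<lambda>_. - 1"] homogeneous_uminus[OF homogeneous_1]
  by simp

lemma homogeneous_signof: "homogeneous 0 (signof p)"
  by (auto simp: sign_def homogeneous_1 homogeneous_uminus)

text \<open>If the degree of an entry is a row weight minus a column weight, then each term of the Leibniz
  expansion collects every row weight once and every column weight once, whatever its
  permutation.\<close>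

lemma homogeneous_det:
  assumes A: "A \<in> carrier_mat n n"
    and hom: "\<And>j i. j < n \<Longrightarrow> i < n \<Longrightarrow> homogeneous (r j - c i) (A $$ (j, i))"
  shows "homogeneous (sum r {0..<n} - sum c {0..<n}) (det A)"
proof -
  have "homogeneous (0 + (sum r {0..<n} - sum c {0..<n})) (signof p * (\<Prod>j = 0..<n. A $$ (j, p j)))"
    if p: "p permutes {0..<n}" for p
  proof (intro homogeneous_mult homogeneous_signof)
    have "homogeneous (\<Sum>j = 0..<n. r j - c (p j)) (\<Prod>j = 0..<n. A $$ (j, p j))"
      using permutes_in_image[OF p] by (intro homogeneous_prod hom) auto
    moreover have "(\<Sum>j = 0..<n. c (p j)) = sum c {0..<n}"
      using sum.permute[OF p, of c] by (simp add: comp_def)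
    ultimately show "homogeneous (sum r {0..<n} - sum c {0..<n}) (\<Prod>j = 0..<n. A $$ (j, p j))"
      by (simp add: sum_subtractf)
  qed
  then show ?thesis
    unfolding det_def'[OF A] by (intro homogeneous_sum) simp
qed

lemma bij_betw_pick_compl:
  assumes "i \<le> m"
  shows "bij_betw (pick (- {i})) {0..<m} ({..m} - {i})"
proof -
  have inf: "infinite (- {i})"
    by (simp add: Compl_eq_Diff_UNIV)
  have card: "card {a. a < Suc m \<and> a \<in> - {i}} = m"
  proof -
    have "{a. a < Suc m \<and> a \<in> - {i}} = {..m} - {i}" by auto
    then show ?thesis using assms by simp
  qed
  have inj: "inj_on (pick (- {i})) {0..<m}"
    using pick_eq_iff_inf[OF inf] by (auto simp: inj_on_def)
  have sub: "pick (- {i}) ` {0..<m} \<subseteq> {..m} - {i}"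
    using pick_le[where i = "Suc m" and S = "- {i}"] pick_in_set_inf[OF inf] card by fastforce
  have "pick (- {i}) ` {0..<m} = {..m} - {i}"
    using sub by (rule card_subset_eq[rotated]) (use assms in \<open>simp_all add: card_image[OF inj]\<close>)
  with inj show ?thesis by (simp add: bij_betw_def)
qed

text \<open>The minor that omits column \<open>i\<close> collects all column weights except \<open>c i\<close>. The columns of the
  submatrix are numbered by \<open>pick\<close>, which lists \<open>{..m} - {i}\<close>.\<close>

lemma homogeneous_maximal_minor:
  assumes A: "A \<in> carrier_mat m (Suc m)"
    and hom: "\<And>j i. j < m \<Longrightarrow> i \<le> m \<Longrightarrow> homogeneous (r j - c i) (A $$ (j, i))"
    and i: "i \<le> m"
  shows "homogeneous (sum r {0..<m} - (sum c {..m} - c i)) (det (submatrix A UNIV (- {i})))"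
proof -
  let ?pick = "pick (- {i})"
  have bij: "bij_betw ?pick {0..<m} ({..m} - {i})"
    by (rule bij_betw_pick_compl[OF i])
  have rows: "card {j. j < dim_row A \<and> j \<in> UNIV} = m"
    using A by simp
  have "{j. j < dim_col A \<and> j \<in> - {i}} = {..m} - {i}"
    using A by auto
  then have cols: "card {j. j < dim_col A \<and> j \<in> - {i}} = m"
    using i by simp
  have le: "?pick k \<le> m" if "k < m" for k
    using bij_betw_apply[OF bij, of k] that by simp
  have "homogeneous (sum r {0..<m} - (\<Sum>k = 0..<m. c (?pick k))) (det (submatrix A UNIV (- {i})))"
  proof (rule homogeneous_det)
    show "submatrix A UNIV (- {i}) \<in> carrier_mat m m"
      by (rule carrier_matI) (simp_all only: dim_submatrix rows cols)
    show "homogeneous (r j - c (?pick k)) (submatrix A UNIV (- {i}) $$ (j, k))"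
      if "j < m" "k < m" for j k
    proof -
      have "submatrix A UNIV (- {i}) $$ (j, k) = A $$ (j, ?pick k)"
        using submatrix_index[of j A UNIV k "- {i}"] that rows cols by (simp add: pick_UNIV)
      then show ?thesis using hom that le by simp
    qed
  qed
  moreover have "(\<Sum>k = 0..<m. c (?pick k)) = sum c {..m} - c i"
    using sum.reindex_bij_betw[OF bij, of c] i by (simp add: sum_diff1)
  ultimately show ?thesis by simp
qed


section \<open>Ideals generated by homogeneous elements\<close>

lemma lookup_hom_component:
  "Poly_Mapping.lookup (hom_component d f) m = (if mon_deg m = d then Poly_Mapping.lookup f m else 0)"
  by (auto simp: hom_component_def lookup_sum lookup_single when_def in_keys_iff)

lemma hom_component_add: "hom_component d (f + g) = hom_component d f + hom_component d g"
  by (rule poly_mapping_eqI) (simp add: lookup_hom_component lookup_add)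

lemma hom_component_0: "hom_component d 0 = 0"
  by (simp add: hom_component_def)

lemma hom_component_sum: "hom_component d (sum f I) = (\<Sum>i\<in>I. hom_component d (f i))"
  by (induction I rule: infinite_finite_induct) (auto simp: hom_component_0 hom_component_add)

lemma hom_component_single:
  "hom_component d (Poly_Mapping.single m a) = (if mon_deg m = d then Poly_Mapping.single m a else 0)"
  by (rule poly_mapping_eqI) (auto simp: lookup_hom_component lookup_single when_def)

lemma hom_component_homogeneous:
  "homogeneous e f \<Longrightarrow> hom_component d f = (if e = d then f else 0)"
  by (rule poly_mapping_eqI) (auto simp: lookup_hom_component homogeneous_def in_keys_iff)

lemma sum_single_lookup: "(\<Sum>m\<in>Poly_Mapping.keys f. Poly_Mapping.single m (Poly_Mapping.lookup f m)) = f"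
  by (rule poly_mapping_eqI) (auto simp: lookup_sum lookup_single when_def in_keys_iff)

lemma hom_component_single_mult:
  "hom_component d (Poly_Mapping.single m a * f) = Poly_Mapping.single m a * hom_component (d - mon_deg m) f"
proof -
  let ?t = "\<lambda>n. Poly_Mapping.single n (Poly_Mapping.lookup f n)"
  have "hom_component d (Poly_Mapping.single m a * ?t n)
      = Poly_Mapping.single m a * hom_component (d - mon_deg m) (?t n)" for n
    by (auto simp: mult_single hom_component_single mon_deg_add algebra_simps)
  then have "hom_component d (Poly_Mapping.single m a * (\<Sum>n\<in>Poly_Mapping.keys f. ?t n))
      = Poly_Mapping.single m a * hom_component (d - mon_deg m) (\<Sum>n\<in>Poly_Mapping.keys f. ?t n)"
    by (simp add: sum_distrib_left hom_component_sum)
  then show ?thesis by (simp only: sum_single_lookup)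
qed

lemma hom_component_mult:
  "hom_component d (g * f) = (\<Sum>m\<in>Poly_Mapping.keys g.
     Poly_Mapping.single m (Poly_Mapping.lookup g m) * hom_component (d - mon_deg m) f)"
proof -
  have "hom_component d (g * f) = hom_component d
      ((\<Sum>m\<in>Poly_Mapping.keys g. Poly_Mapping.single m (Poly_Mapping.lookup g m)) * f)"
    by (simp only: sum_single_lookup)
  then show ?thesis
    by (simp add: sum_distrib_right hom_component_sum hom_component_single_mult)
qed

lemma ring_B2: "ring B2_ring"
proof (rule ringI)
  show "abelian_group B2_ring"
    by (rule abelian_groupI)
      (auto simp: B2_ring_def B2_0 B2_add algebra_simps intro: bexI[OF _ B2_uminus])
  show "Group.monoid B2_ring"
    by (rule monoidI) (auto simp: B2_ring_def B2_1 B2_mult algebra_simps)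
qed (auto simp: B2_ring_def algebra_simps)

lemma B2_ring_simps [simp]:
  "carrier B2_ring = B2" "x \<otimes>\<^bsub>B2_ring\<^esub> y = x * y" "x \<oplus>\<^bsub>B2_ring\<^esub> y = x + y"
  "\<zero>\<^bsub>B2_ring\<^esub> = 0" "\<one>\<^bsub>B2_ring\<^esub> = 1"
  by (simp_all add: B2_ring_def)

lemma ideal_B2_iff:
  fixes I :: "('p::order, 'k::field) poly2 set"
  shows "ideal I B2_ring \<longleftrightarrow> I \<subseteq> B2 \<and> 0 \<in> I \<and> (\<forall>f\<in>I. \<forall>g\<in>I. f + g \<in> I) \<and> (\<forall>f\<in>I. \<forall>g\<in>B2. g * f \<in> I)"
  (is "_ \<longleftrightarrow> ?closed")
proof
  assume "ideal I B2_ring"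
  then interpret ideal I B2_ring .
  show ?closed
    using a_subset I_l_closed additive_subgroup.zero_closed[OF additive_subgroup_axioms]
      additive_subgroup.a_closed[OF additive_subgroup_axioms] by auto
next
  assume closed: ?closed
  interpret ring "B2_ring :: ('p, 'k) poly2 ring" by (rule ring_B2)
  have neg: "\<ominus>\<^bsub>B2_ring\<^esub> f = - f" if "f \<in> B2" for f :: "('p, 'k) poly2"
    using that by (intro minus_equality) (auto simp: B2_uminus)
  show "ideal I B2_ring"
  proof (rule idealI[OF ring_B2])
    show "subgroup I (add_monoid B2_ring)"
    proof (rule add.subgroupI)
      show "\<ominus>\<^bsub>B2_ring\<^esub> f \<in> I" if "f \<in> I" for f
      proof -
        have "(- 1) * f \<in> I"
          using closed that B2_uminus[OF B2_1] by blast
        then show ?thesis using neg closed that by auto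
      qed
    qed (use closed in auto)
  qed (use closed in \<open>auto simp: mult.commute\<close>)
qed

text \<open>The elements of the ideal all of whose components lie in the ideal form an ideal
  themselves, because a component of \<open>g * f\<close> is a combination of components of \<open>f\<close>. This ideal
  contains the generators, hence everything they generate.\<close>

lemma homogeneous_ideal_genideal:
  fixes G :: "('p::{finite,order}, 'k::field) poly2 set"
  assumes "\<And>f. f \<in> G \<Longrightarrow> \<exists>d. homogeneous d f"
  shows "homogeneous_ideal (Idl\<^bsub>B2_ring\<^esub> G)"
proof -
  interpret ring "B2_ring :: ('p, 'k) poly2 ring" by (rule ring_B2)
  let ?I = "Idl\<^bsub>B2_ring\<^esub> G"
  have G: "G \<subseteq> carrier B2_ring"
    using assms homogeneous_in_B2 by auto
  have ideal: "ideal ?I B2_ring"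
    by (rule genideal_ideal[OF G])
  then have I: "?I \<subseteq> B2" "0 \<in> ?I" "\<And>f g. f \<in> ?I \<Longrightarrow> g \<in> ?I \<Longrightarrow> f + g \<in> ?I"
    "\<And>f g. f \<in> ?I \<Longrightarrow> g \<in> B2 \<Longrightarrow> g * f \<in> ?I"
    unfolding ideal_B2_iff by auto
  have I_sum: "sum f A \<in> ?I" if "\<And>i. i \<in> A \<Longrightarrow> f i \<in> ?I" for A and f :: "'c \<Rightarrow> ('p, 'k) poly2"
    using that by (induction A rule: infinite_finite_induct) (auto simp: I)
  let ?K = "{f \<in> ?I. \<forall>d. hom_component d f \<in> ?I}"
  have "ideal ?K B2_ring"
    unfolding ideal_B2_iff
  proof (intro conjI ballI)
    fix f g :: "('p, 'k) poly2"
    assume f: "f \<in> ?K" and g: "g \<in> B2"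
    have "Poly_Mapping.single m (Poly_Mapping.lookup g m) \<in> B2" if "m \<in> Poly_Mapping.keys g" for m
      using g that by (auto simp: B2_def)
    then have "hom_component d (g * f) \<in> ?I" for d
      unfolding hom_component_mult using f by (intro I_sum I) auto
    then show "g * f \<in> ?K"
      using f g I by auto
  qed (use I in \<open>auto simp: hom_component_0 hom_component_add\<close>)
  moreover have "G \<subseteq> ?K"
  proof
    fix f assume f: "f \<in> G"
    then have "f \<in> ?I"
      using genideal_self[OF G] by auto
    moreover obtain e where "homogeneous e f"
      using assms f by auto
    ultimately show "f \<in> ?K"
      using I by (auto simp: hom_component_homogeneous)
  qed
  ultimately have "?I \<subseteq> ?K"
    by (rule genideal_minimal)
  with ideal show ?thesis
    by (auto simp: homogeneous_ideal_def)
qed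


section \<open>Meets in a rooted tree\<close>

lemma siblings_incomparable: "siblings b c \<Longrightarrow> b \<le> c \<Longrightarrow> b = c" for b c :: "'p::order"
  by (auto simp: siblings_def covered_by_def order_le_less)

lemma siblings_sym: "siblings b c \<Longrightarrow> siblings c b" for b c :: "'p::order"
  by (auto simp: siblings_def)

context
  assumes tree: "rooted_tree TYPE('p::{finite,order})"
begin

lemma is_root_iff: "is_root p \<longleftrightarrow> p = root" for p :: 'p
proof -
  have "\<exists>!r::'p. is_root r"
    using tree by (simp add: rooted_tree_def)
  then show ?thesis
    unfolding root_def by (metis the_equality)
qed

lemma not_root_if_covers: "a \<prec> b \<Longrightarrow> b \<noteq> root" for a b :: 'p
  by (metis covered_by_def is_root_def is_root_iff)

lemma covered_by_iff_parent: "a \<prec> b \<longleftrightarrow> b \<noteq> root \<and> a = parent b" for a b :: 'p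
proof (cases "b = root")
  case False
  then have "\<exists>!a. a \<prec> b"
    using tree by (simp add: rooted_tree_def is_root_iff)
  then show ?thesis
    unfolding parent_def using False by (metis theI_unique)
qed (use not_root_if_covers in auto)

lemma le_parent:
  fixes z b :: 'p
  assumes "z < b"
  shows "z \<le> parent b"
proof -
  obtain c where c: "c \<in> {c. z \<le> c \<and> c < b}" "\<forall>d\<in>{c. z \<le> c \<and> c < b}. c \<le> d \<longrightarrow> c = d"
    using finite_has_maximal[of "{c. z \<le> c \<and> c < b}"] assms by auto
  have "c \<prec> b"
    unfolding covered_by_def
  proof (intro conjI notI)
    assume "\<exists>d. c < d \<and> d < b"
    then obtain d where d: "c < d" "d < b" by blast
    then have "z \<le> d" using c(1) by auto
    then show False using c(2) d by auto
  qed (use c(1) in simp)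
  with c show ?thesis by (simp add: covered_by_iff_parent)
qed

text \<open>Two elements of the down-set of \<open>q\<close> other than \<open>q\<close> are both below the parent of \<open>q\<close>, so
  they stay together on the way down until one of them is reached.\<close>

lemma down_set_chain: "a \<le> q \<Longrightarrow> b \<le> q \<Longrightarrow> a \<le> b \<or> b \<le> a" for a b q :: 'p
proof (induction "card {..q}" arbitrary: q rule: less_induct)
  case less
  show ?case
  proof (cases "a = q \<or> b = q")
    case False
    then have ab: "a < q" "b < q" using less.prems by auto
    then have "q \<noteq> root"
      by (metis is_root_def is_root_iff)
    then have "parent q < q"
      using covered_by_iff_parent[of "parent q" q] by (simp add: covered_by_def)
    then have "{..parent q} \<subset> {..q}" by auto
    then show ?thesis
      using less.hyps[of "parent q"] ab le_parent by (simp add: psubset_card_mono)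
  qed (use less.prems in auto)
qed

lemma is_var_U_parent: "a \<prec> b \<Longrightarrow> is_var (U a b)" for a b :: 'p
  by (auto simp: covered_by_iff_parent[of a b] is_meet_def)
    (metis covered_by_def covered_by_iff_parent order_less_imp_le)

text \<open>If \<open>q\<close> lies above a sibling \<open>c\<close> of \<open>b\<close>, then it does not lie above \<open>b\<close>, since
  otherwise \<open>b\<close> and \<open>c\<close> would be comparable; so every common lower bound of \<open>q\<close> and \<open>b\<close> is strictly below \<open>b\<close>.\<close>

lemma is_var_U_sibling:
  fixes b c q :: 'p
  assumes "siblings c b" "c \<noteq> b" "c \<le> q"
  shows "is_var (U q b)"
proof -
  obtain a where a: "a \<prec> c" "a \<prec> b"
    using assms(1) by (auto simp: siblings_def)
  then have par: "b \<noteq> root" "a = parent b"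
    by (simp_all add: covered_by_iff_parent)
  have "\<not> b \<le> q"
    using down_set_chain[of b q c] siblings_incomparable siblings_sym assms by blast
  then have "is_meet a q b"
    using a assms(3) le_parent[of _ b] par(2)
    by (force simp: is_meet_def covered_by_def order_le_less)
  with par show ?thesis by simp
qed

end


section \<open>Degrees of \<open>T\<close>, \<open>S\<close> and \<open>D\<close>\<close>

text \<open>\<open>S\<^sub>c\<close> involves \<open>D\<close> only at \<open>c\<close> and above. Stating its degree for an arbitrary \<open>D\<close> that
  is known to be graded there lets the same lemmas serve both inside the induction that
  determines the degrees of \<open>D\<close> and for the final result.\<close>

definition graded_from :: "'p::{finite,order} \<Rightarrow> ('p \<Rightarrow> 'p \<Rightarrow> ('p, 'k::field) poly2) \<Rightarrow> bool"
  where "graded_from c D \<longleftrightarrow> (\<forall>p\<ge>c. homogeneous (e2 p - hat p) (D p p) \<and>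
    (\<forall>q. p \<prec> q \<longrightarrow> homogeneous (hat q - hat p) (D p q)))"

lemma R_of_refl: "R_of D a a = 1" for a :: "'p::{finite,order}"
proof -
  have none: "{(p, q). a \<le> p \<and> p \<prec> q \<and> q \<le> a} = {}"
    by (auto simp: covered_by_def)
  show ?thesis unfolding R_of_def none by simp
qed

context
  assumes tree: "rooted_tree TYPE('p::{finite,order})"
begin

lemma homogeneous_T_part:
  assumes "c \<prec> b \<or> siblings c b \<and> c \<noteq> b"
  shows "homogeneous (e1 b + hat b) (T_part c b :: ('p, 'k::field) poly2)"
proof -
  have summand: "homogeneous (e1 b + hat b) (x2 q * u q b :: ('p, 'k) poly2)" if "is_var (U q b)" for q
    using homogeneous_mult[OF homogeneous_x2[of q] homogeneous_u[OF that]] by simp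
  show ?thesis
  proof (cases "c \<prec> b")
    case True
    show ?thesis
      unfolding T_part_def if_P[OF True]
      by (intro homogeneous_uminus summand is_var_U_parent[OF tree] True)
  next
    case False
    have "homogeneous (e1 b + hat b) (x2 q * u q b :: ('p, 'k) poly2)" if "q \<in> {q. c \<le> q}" for q
      using assms False that by (intro summand is_var_U_sibling[OF tree, of c]) auto
    then show ?thesis
      unfolding T_part_def if_not_P[OF False] by (intro homogeneous_uminus homogeneous_sum)
  qed
qed

lemma homogeneous_polyT: "homogeneous (e1 p + hat p) (polyT p :: ('p, 'k::field) poly2)"
proof (cases "p = root")
  case True
  then show ?thesis
    using homogeneous_var[of "U0 :: 'p var"] by (simp add: polyT_def)
next
  case False
  then have "parent p \<prec> p"
    by (simp add: covered_by_iff_parent[OF tree])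
  with False show ?thesis
    unfolding polyT_def
    by (auto intro!: homogeneous_diff homogeneous_uminus homogeneous_sum homogeneous_T_part)
qed

text \<open>The covering relations between \<open>a\<close> and \<open>b\<close> are those between \<open>a\<close> and the parent of \<open>b\<close>, together
  with the one at \<open>b\<close>: this splits off the last factor, so that the degrees of the \<open>R(a,b)\<close>
  telescope.\<close>

lemma R_of_parent:
  fixes a b :: 'p
  assumes "a < b"
  shows "R_of D a b = D (parent b) b * R_of D a (parent b)"
proof -
  have "b \<noteq> root"
    using assms by (metis is_root_def is_root_iff[OF tree])
  then have cov: "parent b \<prec> b"
    by (simp add: covered_by_iff_parent[OF tree])
  have edges: "{(p, q). a \<le> p \<and> p \<prec> q \<and> q \<le> b}
      = insert (parent b, b) {(p, q). a \<le> p \<and> p \<prec> q \<and> q \<le> parent b}"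
    (is "?E = insert _ ?E'")
  proof (intro equalityI subsetI)
    fix e assume "e \<in> ?E"
    then obtain p q where e: "e = (p, q)" "a \<le> p" "p \<prec> q" "q \<le> b" by blast
    show "e \<in> insert (parent b, b) ?E'"
    proof (cases "q = b")
      case True
      then show ?thesis using e covered_by_iff_parent[OF tree, of p b] by simp
    next
      case False
      then have "q \<le> parent b" using e(4) by (intro le_parent[OF tree]) simp
      then show ?thesis using e by simp
    qed
  next
    fix e assume "e \<in> insert (parent b, b) ?E'"
    moreover have "parent b \<le> b" using cov by (simp add: covered_by_def order_less_imp_le)
    ultimately show "e \<in> ?E" using le_parent[OF tree assms] cov by auto
  qed
  have "(parent b, b) \<notin> {(p, q). a \<le> p \<and> p \<prec> q \<and> q \<le> parent b}"
    using cov by (auto simp: covered_by_def)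
  then show ?thesis
    unfolding R_of_def edges by (subst prod.insert) auto
qed

lemma homogeneous_R_of:
  fixes c b :: 'p
  assumes "graded_from c D" "c \<le> b"
  shows "homogeneous (hat b - hat c) (R_of D c b)"
  using assms(2)
proof (induction "card {..b}" arbitrary: b rule: less_induct)
  case less
  show ?case
  proof (cases "b = c")
    case True
    then show ?thesis by (simp add: R_of_refl homogeneous_1)
  next
    case False
    with less.prems have lt: "c < b" by simp
    then have "b \<noteq> root"
      by (metis is_root_def is_root_iff[OF tree])
    then have cov: "parent b \<prec> b"
      by (simp add: covered_by_iff_parent[OF tree])
    then have "{..parent b} \<subset> {..b}"
      by (auto simp: covered_by_def)
    then have "homogeneous (hat (parent b) - hat c) (R_of D c (parent b))"
      using less.hyps[of "parent b"] le_parent[OF tree lt] by (simp add: psubset_card_mono)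
    moreover have "homogeneous (hat b - hat (parent b)) (D (parent b) b)"
      using assms(1) le_parent[OF tree lt] cov by (simp add: graded_from_def)
    ultimately have "homogeneous (hat b - hat (parent b) + (hat (parent b) - hat c)) (R_of D c b)"
      unfolding R_of_parent[OF lt] by (intro homogeneous_mult)
    then show ?thesis by simp
  qed
qed

lemma homogeneous_S_of:
  fixes c b :: 'p
  assumes "graded_from c D" "c \<le> b"
  shows "homogeneous (e2 b - hat c) (S_of D c b)"
proof -
  have "homogeneous (e2 b - hat b) (D b b)"
    using assms by (simp add: graded_from_def)
  from homogeneous_mult[OF homogeneous_R_of[OF assms] this] show ?thesis
    by (simp add: S_of_def)
qed

text \<open>At \<open>c = b\<close> the claimed degree is that of the variable \<open>b\<^sub>1\<close>. For other siblings the \<open>e2 q\<close> in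
  the degrees of \<open>u q b\<close> and \<open>S\<^sub>c(q)\<close> cancel, so that all summands have the same degree.\<close>

lemma homogeneous_ST_of_sibling:
  fixes c b :: 'p
  assumes "graded_from c D" "siblings c b"
  shows "homogeneous (e1 b + hat b - hat c) (ST_of D c b)"
proof (cases "c = b")
  case True
  with homogeneous_x1[of b] show ?thesis by (simp add: ST_of_def)
next
  case False
  have summand: "homogeneous (e1 b + hat b - hat c) (u q b * S_of D c q)"
    if "q \<in> {q. c \<le> q}" for q
  proof -
    have "c \<le> q" using that by simp
    from homogeneous_mult[OF homogeneous_u[OF is_var_U_sibling[OF tree assms(2) False this]]
        homogeneous_S_of[OF assms(1) this]]
    show ?thesis by (simp add: algebra_simps)
  qed
  have not_parent: "\<not> c \<prec> b"
    using siblings_incomparable[OF assms(2)] False by (meson covered_by_def order_less_imp_le)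
  show ?thesis
    unfolding ST_of_def if_not_P[OF False] if_not_P[OF not_parent]
    by (intro homogeneous_uminus homogeneous_sum summand)
qed

lemma homogeneous_ST_of_parent:
  fixes a b :: 'p
  assumes "a \<prec> b"
  shows "homogeneous (e1 b + hat b - e2 a) (ST_of D a b)"
proof -
  have "a \<noteq> b" using assms by (auto simp: covered_by_def)
  from homogeneous_uminus[OF homogeneous_u[OF is_var_U_parent[OF tree assms]]] show ?thesis
    unfolding ST_of_def if_not_P[OF \<open>a \<noteq> b\<close>] if_P[OF assms] by (simp add: algebra_simps)
qed

text \<open>Up to sign, \<open>D(a)\<close> at \<open>b\<^sup>i\<close> is the minor of \<open>M(a)\<close> without column \<open>i\<close>. The row weights are
  \<open>e1 b + hat b\<close> for the children \<open>b\<close>, the column weights \<open>e2 a\<close> and then \<open>hat b\<close>. The sum of all row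
  weights is that of all column weights minus \<open>hat a\<close>, so the minor without a column has the weight
  of that column minus \<open>hat a\<close> as its degree.\<close>

lemma homogeneous_D_step:
  fixes kids :: "'p \<Rightarrow> 'p list"
  assumes kids: "enumerates_children kids"
    and D: "\<And>c. a \<prec> c \<Longrightarrow> graded_from c D"
  shows "homogeneous (e2 a - hat a) (D_step kids D a a)"
    and "a \<prec> b \<Longrightarrow> homogeneous (hat b - hat a) (D_step kids D a b)"
proof -
  let ?m = "length (kids a)"
  let ?cols = "a # kids a"
  define r where "r = (\<lambda>j. e1 (kids a ! j) + hat (kids a ! j))"
  define c where "c = (\<lambda>i. if i = 0 then e2 a else hat (?cols ! i))"
  have set_kids: "set (kids a) = {b. a \<prec> b}" and dist: "distinct (kids a)"
    using kids by (auto simp: enumerates_children_def)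
  then have dist_cols: "distinct ?cols"
    by (auto simp: covered_by_def)
  have kid: "a \<prec> kids a ! j" if "j < ?m" for j
    using set_kids nth_mem[OF that] by auto
  have sum_kids: "(\<Sum>j = 0..<?m. f (kids a ! j)) = (\<Sum>b | a \<prec> b. f b)" for f :: "'p \<Rightarrow> 'p deg"
    using sum.reindex_bij_betw[OF bij_betw_nth[OF dist, of "{0..<?m}" "{b. a \<prec> b}"], of f] set_kids
    by (auto simp: lessThan_atLeast0)
  have sum_e1: "(\<Sum>b | a \<prec> b. e1 b) = e2 a - hat a"
    by (simp add: hat_def)
  have sum_r: "sum r {0..<?m} = e2 a - hat a + (\<Sum>b | a \<prec> b. hat b)"
    using sum_kids[of "\<lambda>b. e1 b + hat b"] by (simp only: r_def sum.distrib sum_e1)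
  have sum_c: "sum c {..?m} = e2 a + (\<Sum>b | a \<prec> b. hat b)"
    by (simp add: c_def sum.atMost_shift lessThan_atLeast0 sum_kids[of hat])
  have entry: "homogeneous (r j - c i) (M_of kids D a $$ (j, i))" if "j < ?m" "i \<le> ?m" for j i
  proof (cases i)
    case 0
    then show ?thesis
      using that homogeneous_ST_of_parent[OF kid[OF that(1)]] by (simp add: M_of_def r_def c_def)
  next
    case (Suc k)
    with that have k: "k < ?m" by simp
    have "siblings (kids a ! k) (kids a ! j)"
      using kid[OF k] kid[OF that(1)] by (auto simp: siblings_def)
    from homogeneous_ST_of_sibling[OF D[OF kid[OF k]] this] show ?thesis
      using that Suc by (simp add: M_of_def r_def c_def)
  qed
  have minor: "homogeneous (c i - hat a) (D_step kids D a (?cols ! i))" if i: "i \<le> ?m" for i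
  proof (cases "kids a = []")
    \<comment> \<open>a maximal \<open>a\<close> has its own clause, but the value \<open>1\<close> fits the pattern: \<open>hat a = e2 a\<close>\<close>
    case True
    then have "{b. a \<prec> b} = {}" using set_kids by simp
    with True i show ?thesis by (simp add: D_step_def c_def hat_def homogeneous_1)
  next
    case False
    have "(THE k. k \<le> ?m \<and> ?cols ! k = ?cols ! i) = i"
      using i dist_cols by (intro the_equality) (auto simp: nth_eq_iff_index_eq simp del: nth_Cons_Suc)
    then have "D_step kids D a (?cols ! i) = (- 1) ^ i * det (submatrix (M_of kids D a) UNIV (- {i}))"
      using False by (simp add: D_step_def)
    moreover have "homogeneous (sum r {0..<?m} - (sum c {..?m} - c i))
        (det (submatrix (M_of kids D a) UNIV (- {i})))"
      by (rule homogeneous_maximal_minor) (use entry i in \<open>auto simp: M_of_def\<close>)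
    moreover have "sum r {0..<?m} - (sum c {..?m} - c i) = c i - hat a"
      by (simp add: sum_r sum_c)
    ultimately show ?thesis
      using homogeneous_mult[OF homogeneous_minus_one_power, of "c i - hat a"] by simp
  qed
  show "homogeneous (e2 a - hat a) (D_step kids D a a)"
    using minor[of 0] by (simp add: c_def)
  show "homogeneous (hat b - hat a) (D_step kids D a b)" if ab: "a \<prec> b"
  proof -
    obtain k where "k < ?m" "kids a ! k = b"
      using ab set_kids by (metis in_set_conv_nth mem_Collect_eq)
    then show ?thesis
      using minor[of "Suc k"] by (simp add: c_def)
  qed
qed

lemma graded_from_polyD:
  fixes kids :: "'p \<Rightarrow> 'p list"
  assumes "enumerates_children kids"
  shows "graded_from a (polyD kids :: 'p \<Rightarrow> 'p \<Rightarrow> ('p, 'k::field) poly2)"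
proof (induction "card {a..}" arbitrary: a rule: less_induct)
  case less
  have IH: "graded_from c (polyD kids :: 'p \<Rightarrow> 'p \<Rightarrow> ('p, 'k) poly2)" if "a < c" for c
  proof -
    have "{c..} \<subset> {a..}" using that by auto
    then have "card {c..} < card {a..}" by (simp add: psubset_card_mono)
    then show ?thesis by (rule less.hyps)
  qed
  have step: "graded_from c (polyD kids :: 'p \<Rightarrow> 'p \<Rightarrow> ('p, 'k) poly2)" if "a \<prec> c" for c
    using IH that by (simp add: covered_by_def)
  have "homogeneous (e2 a - hat a) (polyD kids a a :: ('p, 'k) poly2)"
    unfolding polyD_rec[OF assms, of a] by (rule homogeneous_D_step(1)[OF assms step])
  moreover have "homogeneous (hat b - hat a) (polyD kids a b :: ('p, 'k) poly2)" if "a \<prec> b" for b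
    unfolding polyD_rec[OF assms, of a] by (rule homogeneous_D_step(2)[OF assms step that])
  ultimately have "homogeneous (e2 p - hat p) (polyD kids p p :: ('p, 'k) poly2) \<and>
      (\<forall>q. p \<prec> q \<longrightarrow> homogeneous (hat q - hat p) (polyD kids p q :: ('p, 'k) poly2))"
    if "a \<le> p" for p
    using IH[of p] that unfolding graded_from_def by (cases "p = a") auto
  then show ?case
    unfolding graded_from_def by blast
qed

end

theorem proposition5p1:
  fixes kids :: "'p::{finite,order} \<Rightarrow> 'p list"
  assumes "rooted_tree TYPE('p)"
    and "enumerates_children kids"
  shows "homogeneous_ideal (idealJ kids :: ('p, 'k::field) poly2 set) \<and>
    (\<forall>p. homogeneous (e1 p + hat p) (polyT p :: ('p, 'k) poly2)) \<and>
    (\<forall>p q. p \<le> q \<longrightarrow> homogeneous (e2 q - hat p) (polyS kids p q :: ('p, 'k) poly2)) \<and>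
    (\<forall>p q. siblings p q \<longrightarrow>
      homogeneous (e1 p + hat p - hat q) (polyST kids q p :: ('p, 'k) poly2)) \<and>
    (\<forall>p q. p \<prec> q \<longrightarrow> homogeneous (hat q - hat p) (polyD kids p q :: ('p, 'k) poly2)) \<and>
    (\<forall>p. homogeneous (e2 p - hat p) (polyD kids p p :: ('p, 'k) poly2))"
proof (intro conjI allI impI)
  note D = graded_from_polyD[OF assms, where 'k = 'k]
  show T: "homogeneous (e1 p + hat p) (polyT p :: ('p, 'k) poly2)" for p
    by (rule homogeneous_polyT[OF assms(1)])
  show S: "homogeneous (e2 q - hat p) (polyS kids p q :: ('p, 'k) poly2)" if "p \<le> q" for p q
    unfolding polyS_def by (rule homogeneous_S_of[OF assms(1) D that])
  show "homogeneous (e1 p + hat p - hat q) (polyST kids q p :: ('p, 'k) poly2)"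
    if "siblings p q" for p q
    unfolding polyST_def
    by (rule homogeneous_ST_of_sibling[OF assms(1) D siblings_sym[OF that]])
  show "homogeneous (hat q - hat p) (polyD kids p q :: ('p, 'k) poly2)" if "p \<prec> q" for p q
    using D[of p] that unfolding graded_from_def by blast
  show "homogeneous (e2 p - hat p) (polyD kids p p :: ('p, 'k) poly2)" for p
    using D[of p] unfolding graded_from_def by blast
  show "homogeneous_ideal (idealJ kids :: ('p, 'k) poly2 set)"
    unfolding idealJ_def
  proof (rule homogeneous_ideal_genideal)
    fix f :: "('p, 'k) poly2"
    assume "f \<in> {x1 p * x2 q - polyT p * polyS kids p q | p q. p \<le> q}"
    then obtain p q where f: "f = x1 p * x2 q - polyT p * polyS kids p q" and "p \<le> q"
      by blast
    have "homogeneous (e1 p + e2 q) (x1 p * x2 q :: ('p, 'k) poly2)"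
      by (intro homogeneous_mult homogeneous_x1 homogeneous_x2)
    moreover have "homogeneous (e1 p + e2 q) (polyT p * polyS kids p q :: ('p, 'k) poly2)"
      using homogeneous_mult[OF T[of p] S[OF \<open>p \<le> q\<close>]] by simp
    ultimately show "\<exists>d. homogeneous d f"
      unfolding f by (blast intro: homogeneous_diff)
  qed
qed

end
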